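(* Let $p$ be an odd prime, $q=p^e$ with $e\ge 1$, and let $m$ be a nonnegative integer with $p\nmid (m+1)$. If $E_{2m+1}(1,x)$ is a permutation polynomial of $\mathbb{F}_q$, then $m$ is odd and $\gcd(m,q-1)=1$.
   Context: $\mathbb{F}_q$ is the finite field with $q$ elements. For an integer $n\ge 0$, the reversed Dickson polynomial of the second kind (with parameter $1$) is $$E_n(1,x):=\sum_{i=0}^{\lfloor n/2\rfloor}\binom{n-i}{i}(-x)^i\in\mathbb{F}_q[x],$$ where the binomial coefficients are interpreted in $\mathbb{F}_q$. A polynomial in $\mathbb{F}_q[x]$ is a permutation polynomial (PP) of $\mathbb{F}_q$ if the map it induces on $\mathbb{F}_q$ is a bijection. *)

theory Defs
  imports "HOL-Computational_Algebra.Computational_Algebra"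
begin

text \<open>\<open>E\<^sub>n(1, x)\<close>, the parameter being fixed to 1; the binomial coefficients are read in the
  coefficient ring.\<close>

definition rev_dickson2 :: "nat \<Rightarrow> 'a::comm_ring_1 poly" where
  "rev_dickson2 n = (\<Sum>i\<le>n div 2. of_nat ((n - i) choose i) * (- [:0, 1:]) ^ i)"

definition permutation_poly :: "'a::{field,finite} poly \<Rightarrow> bool" where
  "permutation_poly f \<longleftrightarrow> bij (poly f)"

end

theory Submission
  imports Defs "HOL-Number_Theory.Residues"
begin

text \<open>The symmetry behind the theorem becomes visible in the coordinate \<open>t = 1 - 4x\<close>. There
  \<open>4\<^sup>m E\<^bsub>2m+1\<^esub>(1, x)\<close> equals \<open>((1 + u)\<^bsup>2M\<^esup> - (1 - u)\<^bsup>2M\<^esup>) / (4u)\<close> with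
  \<open>M = m + 1\<close> and \<open>u\<^sup>2 = t\<close>, a polynomial of formal degree \<open>m\<close> in \<open>t\<close> whose coefficients, halves
  of the binomials \<open>2M choose (2j + 1)\<close>, form a palindrome. Hence the values at \<open>t\<close> and at
  \<open>1/t\<close> differ only by the factor \<open>t\<^sup>m\<close>. The formal proof reads this off a recurrence in \<open>m\<close>
  (\<open>dickson_odd_reciprocal\<close>), which avoids adjoining a square root of \<open>t\<close>. Injectivity of the
  induced map then has two consequences.

  A permutation has exactly one zero. In the coordinate \<open>t\<close> it is nonzero, because up to
  a power of 4 the value at \<open>t = 0\<close> is \<open>m + 1\<close>, which \<open>p\<close> does not divide. By reciprocity
  the inverse of the zero is again a zero, so the zero is \<open>1\<close> or \<open>-1\<close>. At \<open>t = 1\<close>, that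
  is \<open>x = 0\<close>, the value is 1; so the zero is \<open>-1\<close>. For even \<open>m\<close> the value there is
  a power of \<open>-1/4\<close>; so \<open>m\<close> is odd.

  If \<open>t\<^sup>m = 1\<close>, then \<open>t\<close> and \<open>1/t\<close> give the same value, so \<open>t\<^sup>2 = 1\<close>, and since \<open>m\<close> is
  odd, \<open>t = 1\<close>. But for every divisor \<open>d > 1\<close> of \<open>q - 1\<close> the field has a \<open>d\<close>-th root of
  unity other than 1 (\<open>nontrivial_root_of_unity\<close>), so no such \<open>d\<close> divides \<open>m\<close>.\<close>

section \<open>Recurrences\<close>

text \<open>The binomial coefficients vanish for \<open>i > n div 2\<close>; with the range extended to
  \<open>i \<le> n\<close>, Pascal's rule applies without a case distinction on the parity of \<open>n\<close>.\<close>

lemma poly_rev_dickson2: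
  "poly (rev_dickson2 n) x = (\<Sum>i\<le>n. of_nat ((n - i) choose i) * (- x) ^ i)"
proof -
  have "poly (rev_dickson2 n) x = (\<Sum>i\<le>n div 2. of_nat ((n - i) choose i) * (- x) ^ i)"
    by (simp add: rev_dickson2_def poly_sum)
  also have "\<dots> = (\<Sum>i\<le>n. of_nat ((n - i) choose i) * (- x) ^ i)"
  proof (rule sum.mono_neutral_left)
    show "\<forall>i\<in>{..n} - {..n div 2}. of_nat ((n - i) choose i) * (- x) ^ i = 0"
    proof
      fix i assume "i \<in> {..n} - {..n div 2}"
      then have "n - i < i" by auto
      then show "of_nat ((n - i) choose i) * (- x) ^ i = 0" by (simp add: binomial_eq_0)
    qed
  qed auto
  finally show ?thesis .
qed

text \<open>This is Pascal's rule applied to each coefficient except the constant one.\<close>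

lemma poly_rev_dickson2_Suc_Suc:
  "poly (rev_dickson2 (Suc (Suc n))) x =
     poly (rev_dickson2 (Suc n)) x - x * poly (rev_dickson2 n) x"
proof -
  have "poly (rev_dickson2 (Suc (Suc n))) x =
      1 + (\<Sum>i\<le>n. of_nat ((Suc n - i) choose Suc i) * (- x) ^ Suc i)"
    unfolding poly_rev_dickson2 by (subst sum.atMost_Suc_shift) (simp add: binomial_eq_0)
  also have "(\<Sum>i\<le>n. of_nat ((Suc n - i) choose Suc i) * (- x) ^ Suc i) =
      (\<Sum>i\<le>n. of_nat ((n - i) choose Suc i) * (- x) ^ Suc i) +
      (\<Sum>i\<le>n. of_nat ((n - i) choose i) * (- x) ^ Suc i)"
    unfolding sum.distrib [symmetric]
    by (rule sum.cong) (simp_all add: Suc_diff_le algebra_simps)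
  also have "(\<Sum>i\<le>n. of_nat ((n - i) choose i) * (- x) ^ Suc i) =
      - x * poly (rev_dickson2 n) x"
    by (simp add: poly_rev_dickson2 sum_distrib_left mult_ac sum_negf)
  also have "1 + ((\<Sum>i\<le>n. of_nat ((n - i) choose Suc i) * (- x) ^ Suc i) +
      - x * poly (rev_dickson2 n) x) =
      poly (rev_dickson2 (Suc n)) x - x * poly (rev_dickson2 n) x"
    unfolding poly_rev_dickson2 [of "Suc n"] by (subst sum.atMost_Suc_shift) simp
  finally show ?thesis .
qed

text \<open>The map induced by \<open>E\<^bsub>2m+1\<^esub>(1, x)\<close> in the coordinate \<open>t = 1 - 4x\<close>, the discriminant of
  \<open>Y\<^sup>2 - Y + x\<close>; the symmetry \<open>t \<mapsto> 1/t\<close> is hidden in terms of \<open>x\<close>.\<close>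

definition dickson_odd :: "nat \<Rightarrow> 'a::field \<Rightarrow> 'a" where
  "dickson_odd m t = poly (rev_dickson2 (2 * m + 1)) ((1 - t) / 4)"

lemma dickson_odd_0: "dickson_odd 0 t = 1"
  by (simp add: dickson_odd_def poly_rev_dickson2)

lemma four_neq_0:
  assumes "(2 :: 'a::field) \<noteq> 0"
  shows "(4 :: 'a) \<noteq> 0"
proof -
  have "(4 :: 'a) = 2 * 2" by simp
  then show ?thesis using assms by (metis mult_eq_0_iff)
qed

lemma one_minus_twice_quarter:
  assumes "(2 :: 'a::field) \<noteq> 0"
  shows "1 - 2 * ((1 - t) / 4) = (1 + t) / (2 :: 'a)"
proof -
  have "2 * ((1 - t) / 4) = (1 - t) / 2"
    using assms mult_divide_mult_cancel_left [of 2 "1 - t" 2] by simp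
  then have "1 - 2 * ((1 - t) / 4) = 2 / 2 - (1 - t) / 2"
    by (metis assms divide_self)
  also have "\<dots> = (1 + t) / 2"
    unfolding diff_divide_distrib [symmetric] by simp
  finally show ?thesis .
qed

lemma dickson_odd_1:
  assumes "(2 :: 'a::field) \<noteq> 0"
  shows "dickson_odd (Suc 0) t = (1 + t) / (2 :: 'a)"
proof -
  have "dickson_odd (Suc 0) t = 1 - 2 * ((1 - t) / 4)"
    by (simp add: dickson_odd_def poly_rev_dickson2 numeral_eq_Suc)
  also have "\<dots> = (1 + t) / 2"
    using assms by (rule one_minus_twice_quarter)
  finally show ?thesis .
qed

text \<open>Eliminating the even-indexed terms from two steps of the recurrence of order two gives
  a recurrence for the odd-indexed terms alone, with coefficients
  \<open>1 - 2x = (1 + t) / 2\<close> and \<open>-x\<^sup>2\<close>.\<close>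

lemma dickson_odd_Suc_Suc:
  assumes "(2 :: 'a::field) \<noteq> 0"
  shows "dickson_odd (Suc (Suc m)) t =
    (1 + t) / 2 * dickson_odd (Suc m) t - ((1 - t) / 4) ^ 2 * dickson_odd m (t :: 'a)"
proof -
  define x where "x = (1 - t) / 4"
  have x: "(1 + t) / 2 = 1 - 2 * x"
    unfolding x_def using assms by (rule one_minus_twice_quarter [symmetric])
  define E where "E n = poly (rev_dickson2 n) x" for n
  have rec: "E (Suc (Suc n)) = E (Suc n) - x * E n" for n
    unfolding E_def by (rule poly_rev_dickson2_Suc_Suc)
  define n where "n = 2 * m"
  have even: "E (Suc (Suc n)) = E (Suc (Suc (Suc n))) + x * E (Suc n)"
    using rec [of "Suc n"] by simp
  have "E (Suc (Suc (Suc (Suc (Suc n))))) =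
      E (Suc (Suc (Suc n))) - x * E (Suc (Suc n)) - x * E (Suc (Suc (Suc n)))"
    using rec [of "Suc (Suc n)"] rec [of "Suc (Suc (Suc n))"] by simp
  also have "\<dots> = (1 - 2 * x) * E (Suc (Suc (Suc n))) - x ^ 2 * E (Suc n)"
    unfolding even by (simp add: algebra_simps power2_eq_square)
  finally have "E (Suc (Suc (Suc (Suc (Suc n))))) =
      (1 - 2 * x) * E (Suc (Suc (Suc n))) - x ^ 2 * E (Suc n)" .
  then show ?thesis
    unfolding x by (simp add: dickson_odd_def E_def n_def x_def)
qed

section \<open>Reciprocity and special values\<close>

text \<open>Both coefficients of the recurrence are reciprocal: multiplication by \<open>s\<close> turns
  \<open>1 + t\<close> into \<open>s + 1\<close>, and multiplication by \<open>s\<^sup>2\<close> turns \<open>(1 - t)\<^sup>2\<close> into \<open>(s - 1)\<^sup>2\<close>.\<close>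

lemma dickson_odd_reciprocal:
  fixes s t :: "'a::field"
  assumes two: "(2 :: 'a) \<noteq> 0" and st: "s * t = 1"
  shows "s ^ m * dickson_odd m t = dickson_odd m s"
proof (induction m rule: induct_nat_012)
  case 0
  show ?case by (simp add: dickson_odd_0)
next
  case 1
  show ?case using st by (simp add: dickson_odd_1 two distrib_left add.commute)
next
  case (ge2 m)
  have lin: "s * ((1 + t) / 2) = (1 + s) / 2"
    using st by (simp add: distrib_left add.commute)
  have "s * ((1 - t) / 4) = - ((1 - s) / 4)"
    using st by (metis minus_diff_eq minus_divide_left mult.right_neutral right_diff_distrib
        times_divide_eq_right)
  then have quad: "s ^ 2 * ((1 - t) / 4) ^ 2 = ((1 - s) / 4) ^ 2"
    by (metis power_mult_distrib power2_minus)
  have "s ^ Suc (Suc m) * dickson_odd (Suc (Suc m)) t =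
      (s * ((1 + t) / 2)) * (s ^ Suc m * dickson_odd (Suc m) t) -
      (s ^ 2 * ((1 - t) / 4) ^ 2) * (s ^ m * dickson_odd m t)"
    unfolding dickson_odd_Suc_Suc [OF two]
    by (simp add: right_diff_distrib power2_eq_square mult_ac)
  also have "\<dots> = dickson_odd (Suc (Suc m)) s"
    unfolding lin quad ge2 dickson_odd_Suc_Suc [OF two] ..
  finally show ?case .
qed

text \<open>After multiplication by \<open>4\<^sup>m\<close> the recurrence at \<open>t = 0\<close> reads
  \<open>a\<^bsub>m+2\<^esub> = 2 a\<^bsub>m+1\<^esub> - a\<^sub>m\<close>, so the values form an arithmetic progression.\<close>

lemma dickson_odd_at_0:
  assumes two: "(2 :: 'a::field) \<noteq> 0"
  shows "4 ^ m * dickson_odd m (0 :: 'a) = of_nat (m + 1)"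
proof (induction m rule: induct_nat_012)
  case 0
  show ?case by (simp add: dickson_odd_0)
next
  case 1
  have "(4 :: 'a) / 2 = 2"
    using two by (simp add: divide_eq_eq)
  then show ?case using two by (simp add: dickson_odd_1)
next
  case (ge2 m)
  have half: "4 * ((1 + 0) / 2) = (2 :: 'a)"
    and sixteenth: "4 ^ 2 * ((1 - 0) / 4) ^ 2 = (1 :: 'a)"
    unfolding power_mult_distrib [symmetric] using two four_neq_0 [OF two]
    by (simp_all add: divide_eq_eq)
  have "4 ^ Suc (Suc m) * dickson_odd (Suc (Suc m)) (0 :: 'a) =
      (4 * ((1 + 0) / 2)) * (4 ^ Suc m * dickson_odd (Suc m) 0) -
      (4 ^ 2 * ((1 - 0) / 4) ^ 2) * (4 ^ m * dickson_odd m 0)"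
    unfolding dickson_odd_Suc_Suc [OF two]
    by (simp add: right_diff_distrib power2_eq_square mult_ac)
  also have "\<dots> = of_nat (Suc (Suc m) + 1)"
    unfolding half sixteenth ge2 by simp
  finally show ?case .
qed

lemma dickson_odd_at_1: "dickson_odd m 1 = 1"
proof -
  have "poly (rev_dickson2 n) (0 :: 'a) = 1" for n
    by (simp add: poly_rev_dickson2 power_0_left if_distrib [of "(*) _"] cong: if_cong)
  then show ?thesis by (simp add: dickson_odd_def)
qed

text \<open>The linear coefficient of the recurrence vanishes at \<open>-1\<close>, and what remains is
  a geometric sequence along the even indices.\<close>

lemma dickson_odd_even_at_minus_1:
  assumes two: "(2 :: 'a::field) \<noteq> 0"
  shows "dickson_odd (2 * k) (- 1 :: 'a) \<noteq> 0"
proof (induction k)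
  case 0
  show ?case by (simp add: dickson_odd_0)
next
  case (Suc k)
  have "((1 - (- 1)) / 4) ^ 2 \<noteq> (0 :: 'a)" using two four_neq_0 [OF two] by simp
  moreover have "dickson_odd (2 * Suc k) (- 1) =
      - (((1 - (- 1)) / 4) ^ 2 * dickson_odd (2 * k) (- 1 :: 'a))"
    using dickson_odd_Suc_Suc [OF two, of "2 * k" "- 1"] by simp
  ultimately show ?case
    using Suc by simp
qed

section \<open>Finite fields\<close>

text \<open>Multiplication by \<open>s\<close> permutes the units, so it does not change their product.\<close>

lemma unit_power_CARD_minus_1:
  fixes s :: "'a::{field,finite}"
  assumes "s \<noteq> 0"
  shows "s ^ (card (UNIV :: 'a set) - 1) = 1"
proof -
  have "bij_betw ((*) s) (UNIV - {0}) (UNIV - {0})"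
    by (rule bij_betw_byWitness [where f' = "(*) (inverse s)"]) (use assms in auto)
  then have "(\<Prod>y\<in>UNIV - {0}. s * y) = \<Prod>(UNIV - {0})"
    by (rule prod.reindex_bij_betw)
  moreover have "\<Prod>(UNIV - {0 :: 'a}) \<noteq> 0" by simp
  ultimately show ?thesis by (simp add: prod.distrib card_Diff_singleton)
qed

text \<open>With \<open>q - 1 = d k\<close>, a \<open>k\<close>-th power of a unit is a \<open>d\<close>-th root of unity. Not all of
  these powers are 1, since \<open>X\<^sup>k - 1\<close> has fewer than \<open>q - 1\<close> roots.\<close>

lemma nontrivial_root_of_unity:
  assumes d: "d dvd card (UNIV :: 'a::{field,finite} set) - 1" and "d > 1"
  obtains t :: "'a::{field,finite}" where "t ^ d = 1" and "t \<noteq> 1"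
proof -
  define q where "q = card (UNIV :: 'a set)"
  obtain k where k: "q - 1 = d * k" using d by (auto simp: q_def)
  have units: "card (UNIV - {0 :: 'a}) = q - 1" by (simp add: q_def card_Diff_singleton)
  have "q - 1 > 0"
  proof -
    have "1 \<in> UNIV - {0 :: 'a}" by simp
    then show ?thesis unfolding units [symmetric] card_gt_0_iff by (metis empty_iff finite)
  qed
  then have "k > 0" using k by (metis gr0I mult_0_right)
  then have "k < q - 1" using k \<open>d > 1\<close> by simp
  have "\<exists>s :: 'a. s \<noteq> 0 \<and> s ^ k \<noteq> 1"
  proof (rule ccontr)
    assume "\<not> ?thesis"
    then have "UNIV - {0 :: 'a} \<subseteq> {s. s ^ k = 1}" by blast
    then have "q - 1 \<le> card {s :: 'a. s ^ k = 1}"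
      unfolding units [symmetric] by (intro card_mono) auto
    also have "{s :: 'a. s ^ k = 1} = {s. poly (Polynomial.monom 1 k - 1) s = 0}"
      by (simp add: poly_monom)
    also have "card \<dots> \<le> degree (Polynomial.monom 1 k - 1 :: 'a poly)"
    proof (rule card_poly_roots_bound)
      have "poly (Polynomial.monom 1 k - 1) (0 :: 'a) \<noteq> 0"
        using \<open>k > 0\<close> by (simp add: poly_monom zero_power)
      then show "Polynomial.monom 1 k - 1 \<noteq> (0 :: 'a poly)" by (metis poly_0)
    qed
    also have "\<dots> \<le> k" by (intro Polynomial.degree_diff_le Polynomial.degree_monom_le) simp
    finally show False using \<open>k < q - 1\<close> by simp
  qed
  then obtain s :: 'a where s: "s \<noteq> 0" "s ^ k \<noteq> 1" by blast
  have "s ^ (q - 1) = 1" unfolding q_def using s(1) by (rule unit_power_CARD_minus_1)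
  then have "(s ^ k) ^ d = 1" by (metis k mult.commute power_mult)
  with s(2) that show ?thesis by blast
qed

lemma CHAR_eq_prime_if_CARD_eq_power:
  assumes "prime p" and "card (UNIV :: 'a::{field,finite} set) = p ^ e"
  shows "CHAR('a) = p"
proof -
  have "prime CHAR('a)" by (intro prime_CHAR_semidom finite_imp_CHAR_pos) simp
  moreover have "CHAR('a) dvd p ^ e"
    unfolding assms(2) [symmetric] by (rule CHAR_dvd_CARD)
  then have "CHAR('a) dvd p"
    using \<open>prime CHAR('a)\<close> by (rule prime_dvd_power [rotated])
  ultimately show ?thesis
    using assms(1) by (intro primes_dvd_imp_eq)
qed

lemma bij_dickson_odd:
  assumes two: "(2 :: 'a::{field,finite}) \<noteq> 0"
    and "permutation_poly (rev_dickson2 (2 * m + 1) :: 'a poly)"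
  shows "bij (dickson_odd m :: 'a \<Rightarrow> 'a)"
proof -
  have "inj (\<lambda>t :: 'a. (1 - t) / 4)"
    using four_neq_0 [OF two] by (auto intro!: injI)
  moreover have "inj (poly (rev_dickson2 (2 * m + 1) :: 'a poly))"
    using assms(2) by (simp add: permutation_poly_def bij_is_inj)
  ultimately have "inj (\<lambda>t :: 'a. poly (rev_dickson2 (2 * m + 1)) ((1 - t) / 4))"
    using inj_compose [of "poly (rev_dickson2 (2 * m + 1))" "\<lambda>t :: 'a. (1 - t) / 4"]
    by (simp add: comp_def)
  then have "inj (dickson_odd m :: 'a \<Rightarrow> 'a)"
    by (simp add: dickson_odd_def [abs_def])
  then show ?thesis
    by (simp add: bij_def finite_UNIV_inj_surj)
qed

section \<open>Necessary conditions for a permutation polynomial\<close>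

theorem theorem3p3:
  fixes p e q m :: nat
  assumes "prime p" and "odd p" and "e \<ge> 1" and "q = p ^ e"
    and "card (UNIV :: 'a::{field,finite} set) = q"
    and "\<not> p dvd (m + 1)"
    and "permutation_poly (rev_dickson2 (2 * m + 1) :: 'a poly)"
  shows "odd m \<and> gcd m (q - 1) = 1"
proof -
  have char: "CHAR('a) = p"
    by (rule CHAR_eq_prime_if_CARD_eq_power [OF assms(1)]) (simp only: assms(4,5))
  have "\<not> p dvd 2"
    using primes_dvd_imp_eq [OF assms(1) two_is_prime_nat] assms(2) by auto
  then have two: "(2 :: 'a) \<noteq> 0"
    using of_nat_eq_0_iff_char_dvd [where 'a = 'a, of 2] char by simp
  have bij: "bij (dickson_odd m :: 'a \<Rightarrow> 'a)"
    using two assms(7) by (rule bij_dickson_odd)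
  note inj = bij_is_inj [OF bij, THEN injD]
  have odd: "odd m"
  proof
    assume "even m"
    obtain z :: 'a where z: "dickson_odd m z = 0"
      using bij_is_surj [OF bij] by (metis surjD)
    have "of_nat (m + 1) \<noteq> (0 :: 'a)"
      using assms(6) char of_nat_eq_0_iff_char_dvd [where 'a = 'a, of "m + 1"] by simp
    then have "z \<noteq> 0"
      using z dickson_odd_at_0 [OF two, of m] by auto
    then have "dickson_odd m (inverse z) = 0"
      using dickson_odd_reciprocal [OF two, of "inverse z" z m] z by simp
    then have "inverse z = z" using z inj by simp
    then have "z ^ 2 = 1" using \<open>z \<noteq> 0\<close> by (metis left_inverse power2_eq_square)
    then have "z = 1 \<or> z = - 1" by (simp add: power2_eq_1_iff)
    then show False
      using z \<open>even m\<close> dickson_odd_at_1 [of m, where 'a = 'a] dickson_odd_even_at_minus_1 [OF two]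
      by (auto elim!: evenE)
  qed
  have trivial: "t = 1" if t: "t ^ m = 1" for t :: 'a
  proof -
    have "t \<noteq> 0" using t odd by (metis even_zero power_0_left zero_neq_one)
    then have "dickson_odd m (inverse t) = dickson_odd m t"
      using dickson_odd_reciprocal [OF two, of t "inverse t" m] t by simp
    then have "inverse t = t" by (rule inj)
    then have "t ^ 2 = 1" using \<open>t \<noteq> 0\<close> by (metis left_inverse power2_eq_square)
    moreover obtain k where "m = 2 * k + 1" using odd by (elim oddE)
    ultimately show ?thesis using t by (simp add: power_mult)
  qed
  have "gcd m (q - 1) = 1"
  proof (rule ccontr)
    assume "gcd m (q - 1) \<noteq> 1"
    moreover have "gcd m (q - 1) > 0" using odd_pos [OF odd] by simp
    ultimately have "gcd m (q - 1) > 1" by linarith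
    then obtain t :: 'a where t: "t ^ gcd m (q - 1) = 1" "t \<noteq> 1"
      using nontrivial_root_of_unity [where 'a = 'a, of "gcd m (q - 1)"] assms(5) by auto
    obtain k where "m = gcd m (q - 1) * k" by (meson dvdE gcd_dvd1)
    then have "t ^ m = 1" using t(1) by (metis power_mult power_one)
    then show False using trivial t(2) by blast
  qed
  with odd show ?thesis by blast
qed

end
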